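(* Let $n,m\ge 0$ be integers. The cross product of the dual third order Jacobsthal vectors $\overrightarrow{JD_{n}^{(3)}}$ and $\overrightarrow{JD_{m}^{(3)}}$ is $$\overrightarrow{JD_{n}^{(3)}}\times\overrightarrow{JD_{m}^{(3)}}=\frac{1}{7}\Big(2^{n+1}(ZD_{m+1}+2\varepsilon Z_{m+1})-2^{m+1}(ZD_{n+1}+2\varepsilon Z_{n+1})+U_{n-m}(1-\varepsilon)(\mathbf{i}+\mathbf{j}+\mathbf{k})\Big),$$ where, for integers $l$, $Z_{l}=2U_{l+1}\mathbf{i}+W_{l+1}\mathbf{j}+U_{l}\mathbf{k}$, $ZD_{l}=Z_{l}+\varepsilon Z_{l+1}$, $U_{l}=H_{l}(0,1)$, $W_{l}=H_{l}(2,-1)$, and $\mathbf{i}=(1,0,0)$, $\mathbf{j}=(0,1,0)$, $\mathbf{k}=(0,0,1)$.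
   Context: Dual numbers are $a+\varepsilon b$ with $a,b\in\mathbb{R}$, $\varepsilon\ne0$, $\varepsilon^2=0$. The third order Jacobsthal numbers are defined by $J_0^{(3)}=0$, $J_1^{(3)}=J_2^{(3)}=1$, $J_{n+3}^{(3)}=J_{n+2}^{(3)}+J_{n+1}^{(3)}+2J_n^{(3)}$ for $n\ge0$. For $n\ge0$ let $\overrightarrow{J_n^{(3)}}=(J_n^{(3)},J_{n+1}^{(3)},J_{n+2}^{(3)})\in\mathbb{R}^3$, and define the dual third order Jacobsthal vector $\overrightarrow{JD_n^{(3)}}=\overrightarrow{J_n^{(3)}}+\varepsilon\overrightarrow{J_{n+1}^{(3)}}$. The cross product of dual vectors $\overrightarrow{d_i}=\overrightarrow{a_i}+\varepsilon\overrightarrow{b_i}$ ($\overrightarrow{a_i},\overrightarrow{b_i}\in\mathbb{R}^3$, $i=1,2$) is the dual vector $\overrightarrow{d_1}\times\overrightarrow{d_2}=\overrightarrow{a_1}\times\overrightarrow{a_2}+\varepsilon(\overrightarrow{a_1}\times\overrightarrow{b_2}+\overrightarrow{b_1}\times\overrightarrow{a_2})$, with the standard cross product on $\mathbb{R}^3$ on the right. For real $a,b$ and an integer $n$ (possibly negative), $H_n(a,b)=a$ if $n\equiv0\pmod 3$, $H_n(a,b)=b$ if $n\equiv1\pmod 3$, $H_n(a,b)=-(a+b)$ if $n\equiv2\pmod 3$. *)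

theory Defs
  imports "HOL-Analysis.Analysis"
begin

text \<open>\<open>Dual a b\<close> is the dual number $a + \varepsilon b$.\<close>

datatype dual_num = Dual (real_part: real) (dual_part: real)

instantiation dual_num :: comm_ring_1
begin

definition "0 = Dual 0 0"
definition "1 = Dual 1 0"
definition "x + y = Dual (real_part x + real_part y) (dual_part x + dual_part y)"
definition "- x = Dual (- real_part x) (- dual_part x)"
definition "x - y = Dual (real_part x - real_part y) (dual_part x - dual_part y)"
definition "x * y = Dual (real_part x * real_part y)
                         (real_part x * dual_part y + dual_part x * real_part y)"

instance
  by standard
     (simp_all add: zero_dual_num_def one_dual_num_def plus_dual_num_def uminus_dual_num_def
        minus_dual_num_def times_dual_num_def algebra_simps)

end

instantiation dual_num :: real_algebra_1
begin

definition "r *\<^sub>R x = Dual (r * real_part x) (r * dual_part x)"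

instance
  by standard
     (simp_all add: scaleR_dual_num_def plus_dual_num_def times_dual_num_def algebra_simps)

end

definition eps :: dual_num  (\<open>\<epsilon>\<close>)
  where "\<epsilon> = Dual 0 1"

lemma eps_nonzero: "\<epsilon> \<noteq> 0"
  by (simp add: eps_def zero_dual_num_def)

lemma eps_square: "\<epsilon>\<^sup>2 = 0"
  by (simp add: eps_def power2_eq_square times_dual_num_def zero_dual_num_def)

lemma Dual_eq: "Dual a b = of_real a + \<epsilon> * of_real b"
  by (simp add: of_real_def eps_def scaleR_dual_num_def one_dual_num_def plus_dual_num_def
      times_dual_num_def)

definition of_real_vec :: "real ^ 3 \<Rightarrow> dual_num ^ 3"
  where "of_real_vec v = (\<chi> i. of_real (v $ i))"

definition real_part_vec :: "dual_num ^ 3 \<Rightarrow> real ^ 3"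
  where "real_part_vec d = (\<chi> i. real_part (d $ i))"

definition dual_part_vec :: "dual_num ^ 3 \<Rightarrow> real ^ 3"
  where "dual_part_vec d = (\<chi> i. dual_part (d $ i))"

definition dual_cross3 :: "dual_num ^ 3 \<Rightarrow> dual_num ^ 3 \<Rightarrow> dual_num ^ 3"
  where "dual_cross3 d1 d2 =
    (let a1 = real_part_vec d1; b1 = dual_part_vec d1;
         a2 = real_part_vec d2; b2 = dual_part_vec d2
     in of_real_vec (cross3 a1 a2) + \<epsilon> *s of_real_vec (cross3 a1 b2 + cross3 b1 a2))"

lemma of_real_vec_add_eps_nth: "(of_real_vec a + \<epsilon> *s of_real_vec b) $ i = Dual (a $ i) (b $ i)"
  by (simp add: of_real_vec_def Dual_eq)

lemma dual_vec_eq: "d = of_real_vec (real_part_vec d) + \<epsilon> *s of_real_vec (dual_part_vec d)"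
  by (simp only: vec_eq_iff of_real_vec_add_eps_nth)
     (simp add: real_part_vec_def dual_part_vec_def)

lemma dual_cross3_eq:
  "dual_cross3 (of_real_vec a1 + \<epsilon> *s of_real_vec b1) (of_real_vec a2 + \<epsilon> *s of_real_vec b2) =
     of_real_vec (cross3 a1 a2) + \<epsilon> *s of_real_vec (cross3 a1 b2 + cross3 b1 a2)"
  by (simp only: dual_cross3_def real_part_vec_def dual_part_vec_def of_real_vec_add_eps_nth
      dual_num.sel vec_nth_inverse Let_def)

fun jacobsthal3 :: "nat \<Rightarrow> nat"
  where
    "jacobsthal3 0 = 0"
  | "jacobsthal3 (Suc 0) = 1"
  | "jacobsthal3 (Suc (Suc 0)) = 1"
  | "jacobsthal3 (Suc (Suc (Suc n))) =
       jacobsthal3 (Suc (Suc n)) + jacobsthal3 (Suc n) + 2 * jacobsthal3 n"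

definition jacobsthal3_vec :: "nat \<Rightarrow> real ^ 3"
  where "jacobsthal3_vec n =
    vector [real (jacobsthal3 n), real (jacobsthal3 (n + 1)), real (jacobsthal3 (n + 2))]"

definition JD :: "nat \<Rightarrow> dual_num ^ 3"
  where "JD n = of_real_vec (jacobsthal3_vec n) + \<epsilon> *s of_real_vec (jacobsthal3_vec (n + 1))"

definition H :: "int \<Rightarrow> real \<Rightarrow> real \<Rightarrow> real"
  where "H n a b = (if n mod 3 = 0 then a else if n mod 3 = 1 then b else - (a + b))"

definition U :: "int \<Rightarrow> real"
  where "U l = H l 0 1"

definition W :: "int \<Rightarrow> real"
  where "W l = H l 2 (- 1)"

definition unit_i :: "real ^ 3"  (\<open>\<^bold>i\<close>)
  where "\<^bold>i = vector [1, 0, 0]"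

definition unit_j :: "real ^ 3"  (\<open>\<^bold>j\<close>)
  where "\<^bold>j = vector [0, 1, 0]"

definition unit_k :: "real ^ 3"  (\<open>\<^bold>k\<close>)
  where "\<^bold>k = vector [0, 0, 1]"

definition Z :: "int \<Rightarrow> real ^ 3"
  where "Z l = (2 * U (l + 1)) *\<^sub>R \<^bold>i + W (l + 1) *\<^sub>R \<^bold>j + U l *\<^sub>R \<^bold>k"

definition ZD :: "int \<Rightarrow> dual_num ^ 3"
  where "ZD l = of_real_vec (Z l) + \<epsilon> *s of_real_vec (Z (l + 1))"

end

theory Submission
  imports Defs
begin

text \<open>
  The characteristic polynomial of the recurrence is
  \<open>x\<^sup>3 - x\<^sup>2 - x - 2 = (x - 2) * (x\<^sup>2 + x + 1)\<close>. Hence seven times the \<open>n\<close>-th number is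
  \<open>2 ^ (n + 1)\<close> minus a term of period three (\<open>jacobsthal3_Binet\<close>). With \<open>J n\<close> for the
  vector of three consecutive numbers, \<open>7 * J n = 2 ^ (n + 1) * t - v n\<close>, where
  \<open>t = (1, 2, 4)\<close> and \<open>v\<close> has period three. In \<open>J n \<times> J m\<close> the term \<open>t \<times> t\<close> vanishes, and the
  two mixed terms are governed by \<open>t \<times> v m = - 7 * Z (m + 1)\<close> and its analogue for \<open>n\<close>. All
  \<open>v n\<close> lie in the plane orthogonal to \<open>(1, 1, 1)\<close>, so \<open>v n \<times> v m\<close> is a multiple of
  \<open>(1, 1, 1)\<close>; the factor is seven times a \<open>2 \<times> 2\<close> determinant in \<open>U\<close>, which equals
  \<open>U (n - m)\<close> by d'Ocagne's identity (\<open>U_diff\<close>). This gives the formula for real vectors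
  (\<open>cross3_jacobsthal3_vec\<close>).

  The dual part of the dual cross product is \<open>J n \<times> J (m + 1) + J (n + 1) \<times> J m\<close>, so it
  follows from the real formula at shifted indices. A shift of the index of \<open>Z\<close> produces the dual
  part of \<open>ZD\<close>; a shift in the exponent of two doubles the weight and produces \<open>2 * \<epsilon>\<close> times
  \<open>Z\<close>. The coefficients \<open>U (n - m - 1)\<close> and \<open>U (n - m + 1)\<close> of \<open>(1, 1, 1)\<close> add up to
  \<open>- U (n - m)\<close>, which is where the factor \<open>1 - \<epsilon>\<close> comes from.
\<close>

lemma H_add_2: "H (l + 2) a b = - H l a b - H (l + 1) a b"
proof -
  have "l mod 3 = 0 \<and> (l + 1) mod 3 = 1 \<and> (l + 2) mod 3 = 2 \<or>
        l mod 3 = 1 \<and> (l + 1) mod 3 = 2 \<and> (l + 2) mod 3 = 0 \<or>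
        l mod 3 = 2 \<and> (l + 1) mod 3 = 0 \<and> (l + 2) mod 3 = 1"
    by presburger
  then show ?thesis by (auto simp: H_def)
qed

lemma U_add_2: "U (l + 2) = - U l - U (l + 1)"
  unfolding U_def by (rule H_add_2)

text \<open>The sequences \<open>\<lambda>l. H l a b\<close> form a two-dimensional space, spanned by \<open>U\<close> and its shift.
  These coordinates turn identities between such sequences into polynomial identities.\<close>

lemma H_eq_U: "H l a b = a * U (l + 1) + (a + b) * U l"
proof -
  have "l mod 3 = 0 \<and> (l + 1) mod 3 = 1 \<or> l mod 3 = 1 \<and> (l + 1) mod 3 = 2 \<or>
        l mod 3 = 2 \<and> (l + 1) mod 3 = 0"
    by presburger
  then show ?thesis by (auto simp: U_def H_def)
qed

text \<open>D'Ocagne's identity for the recurrence \<open>U (l + 2) = - U (l + 1) - U l\<close>. Both sides have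
  period three in each index, which leaves nine cases.\<close>

lemma U_diff: "U (n - m) = U n * U (m + 1) - U (n + 1) * U m"
proof -
  have n: "n mod 3 = 0 \<and> (n + 1) mod 3 = 1 \<or> n mod 3 = 1 \<and> (n + 1) mod 3 = 2 \<or>
           n mod 3 = 2 \<and> (n + 1) mod 3 = 0"
    by presburger
  have m: "m mod 3 = 0 \<and> (m + 1) mod 3 = 1 \<or> m mod 3 = 1 \<and> (m + 1) mod 3 = 2 \<or>
           m mod 3 = 2 \<and> (m + 1) mod 3 = 0"
    by presburger
  have "U (n - m) = (if n mod 3 = m mod 3 then 0 else if n mod 3 = (m + 1) mod 3 then 1 else - 1)"
  proof -
    have "(n - m) mod 3 = 0 \<longleftrightarrow> n mod 3 = m mod 3" "(n - m) mod 3 = 1 \<longleftrightarrow> n mod 3 = (m + 1) mod 3"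
      by presburger+
    then show ?thesis by (simp add: U_def H_def)
  qed
  with n m show ?thesis by (elim disjE conjE) (simp_all add: U_def H_def)
qed

text \<open>The Binet formula in real form: up to the factor \<open>- 1 / 7\<close>, \<open>H n 2 (- 3)\<close> is the combined
  contribution of the two non-real roots of the characteristic polynomial, the primitive cube
  roots of unity.\<close>

lemma jacobsthal3_Binet: "real (jacobsthal3 n) = (2 ^ (n + 1) - H (int n) 2 (- 3)) / 7"
proof (induction n rule: jacobsthal3.induct)
  case (4 n)
  let ?H = "\<lambda>k. H (int k) 2 (- 3)"
  have "?H (Suc (Suc n)) = - ?H n - ?H (Suc n)"
    using H_add_2[of "int n"] by (simp add: add.commute)
  moreover have "?H (Suc (Suc (Suc n))) = ?H n"
    by (simp add: H_def)
  ultimately show ?case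
    unfolding jacobsthal3.simps(4) of_nat_add of_nat_mult 4
    by (simp add: add_divide_distrib diff_divide_distrib)
qed (simp_all add: H_def)

text \<open>Once \<open>J\<close> and \<open>Z\<close> are written in \<open>U l\<close> and \<open>U (l + 1)\<close>, and \<open>U (n - m)\<close> is expanded by
  d'Ocagne's identity, each coordinate is a polynomial identity in the six indeterminates
  \<open>2 ^ n\<close>, \<open>U n\<close>, \<open>U (n + 1)\<close>, \<open>2 ^ m\<close>, \<open>U m\<close>, \<open>U (m + 1)\<close>.\<close>

lemma cross3_jacobsthal3_vec:
  "cross3 (jacobsthal3_vec n) (jacobsthal3_vec m) =
    (1 / 7) *\<^sub>R (2 ^ (n + 1) *\<^sub>R Z (int m + 1) - 2 ^ (m + 1) *\<^sub>R Z (int n + 1)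
      + U (int n - int m) *\<^sub>R (\<^bold>i + \<^bold>j + \<^bold>k))"
proof -
  have J: "jacobsthal3_vec k = (1 / 7) *\<^sub>R vector
      [2 * 2 ^ k - 2 * U (int k + 1) + U (int k),
       4 * 2 ^ k + 3 * U (int k + 1) + 2 * U (int k),
       8 * 2 ^ k - U (int k + 1) - 3 * U (int k)]" for k
  proof -
    have H0: "H (int k) 2 (- 3) = 2 * U (int k + 1) - U (int k)"
      by (simp add: H_eq_U)
    have H1: "H (int k + 1) 2 (- 3) = - 3 * U (int k + 1) - 2 * U (int k)"
      using U_add_2[of "int k"] by (simp add: H_eq_U add.commute)
    have H2: "H (int k + 2) 2 (- 3) = U (int k + 1) + 3 * U (int k)"
      by (simp only: H_add_2 H0 H1)
    show ?thesis
      unfolding jacobsthal3_vec_def jacobsthal3_Binet of_nat_add of_nat_1 of_nat_numeral H0 H1 H2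
      by (simp add: vec_eq_iff forall_3 power_add)
  qed
  have Z: "Z (l + 1) = (- 2 * U l - 2 * U (l + 1)) *\<^sub>R \<^bold>i + (U l - U (l + 1)) *\<^sub>R \<^bold>j
             + U (l + 1) *\<^sub>R \<^bold>k" for l
  proof -
    have "W (l + 2) = U l - U (l + 1)"
      unfolding W_def H_add_2 using U_add_2[of l] by (simp add: H_eq_U add.commute)
    with U_add_2[of l] show ?thesis
      by (simp add: Z_def add.assoc)
  qed
  show ?thesis
    unfolding J Z U_diff
    by (simp add: vec_eq_iff forall_3 cross3_def unit_i_def unit_j_def unit_k_def)
       (simp add: field_simps)
qed

theorem theorem3p3:
  fixes n m :: nat
  shows "dual_cross3 (JD n) (JD m) =
    (1 / 7) *\<^sub>R
      (2 ^ (n + 1) *\<^sub>R (ZD (int m + 1) + (2 * \<epsilon>) *s of_real_vec (Z (int m + 1)))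
       - 2 ^ (m + 1) *\<^sub>R (ZD (int n + 1) + (2 * \<epsilon>) *s of_real_vec (Z (int n + 1)))
       + U (int n - int m) *\<^sub>R ((1 - \<epsilon>) *s of_real_vec (\<^bold>i + \<^bold>j + \<^bold>k)))"
proof -
  let ?J = jacobsthal3_vec
  let ?s = "\<^bold>i + \<^bold>j + \<^bold>k"
  have U_sum: "U (int n - int (m + 1)) + U (int (n + 1) - int m) = - U (int n - int m)"
    using U_add_2[of "int n - int m - 1"] by (simp add: algebra_simps)
  have s_sum: "U (int n - int (m + 1)) *\<^sub>R ?s + U (int (n + 1) - int m) *\<^sub>R ?s
      = - U (int n - int m) *\<^sub>R ?s"
    by (simp only: U_sum flip: scaleR_left.add)
  have "cross3 (?J n) (?J (m + 1)) + cross3 (?J (n + 1)) (?J m) =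
      (1 / 7) *\<^sub>R (2 ^ (n + 1) *\<^sub>R Z (int m + 2) - 2 ^ (m + 2) *\<^sub>R Z (int n + 1)
        + 2 ^ (n + 2) *\<^sub>R Z (int m + 1) - 2 ^ (m + 1) *\<^sub>R Z (int n + 2)
        + (U (int n - int (m + 1)) *\<^sub>R ?s + U (int (n + 1) - int m) *\<^sub>R ?s))"
    unfolding cross3_jacobsthal3_vec by (simp add: algebra_simps)
  then have dual: "cross3 (?J n) (?J (m + 1)) + cross3 (?J (n + 1)) (?J m) =
      (1 / 7) *\<^sub>R (2 ^ (n + 1) *\<^sub>R Z (int m + 2) - 2 ^ (m + 2) *\<^sub>R Z (int n + 1)
        + 2 ^ (n + 2) *\<^sub>R Z (int m + 1) - 2 ^ (m + 1) *\<^sub>R Z (int n + 2)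
        - U (int n - int m) *\<^sub>R ?s)"
    unfolding s_sum by simp
  have two: "2 = Dual 2 0"
    unfolding one_add_one[symmetric] by (simp add: one_dual_num_def plus_dual_num_def)
  show ?thesis
    unfolding JD_def dual_cross3_eq dual unfolding cross3_jacobsthal3_vec
    by (simp add: vec_eq_iff ZD_def of_real_vec_def two eps_def of_real_def scaleR_dual_num_def
        one_dual_num_def plus_dual_num_def minus_dual_num_def times_dual_num_def)
       (simp add: algebra_simps)
qed

end
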